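(* Let $z_0$ be a root of $g(z)$ that is inside the unit circle, with multiplicity $m$, and fix $\rho$ satisfying $|z_0|<\rho<1$. Then there is a constant $K$ such that for all sufficiently large $n$ the circle of radius $\epsilon=K(\rho^{1/m})^{2n}$ centered at $z_0$ contains (in its interior, counted with multiplicity) $m$ roots of $z^{2n}-g(z)$.
   Context: Let $b_0,b_1,c_{-1},c_0\in\mathbb{C}$ and let $g$ be the rational function $$g(z)=\frac{(b_1z^2+b_0z+1)(c_{-1}z^2+c_0z+1)}{(b_1+b_0z+z^2)(c_{-1}+c_0z+z^2)}.$$ Here $n$ ranges over positive integers, and $g$ does not depend on $n$. *)

theory Defs
  imports "HOL-Complex_Analysis.Complex_Analysis"
begin

definition g_fun :: "complex \<Rightarrow> complex \<Rightarrow> complex \<Rightarrow> complex \<Rightarrow> complex \<Rightarrow> complex" where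
  "g_fun b0 b1 cm1 c0 z =
     ((b1 * z^2 + b0 * z + 1) * (cm1 * z^2 + c0 * z + 1)) /
     ((b1 + b0 * z + z^2) * (cm1 + c0 * z + z^2))"

text \<open>
  Numerator and denominator of \<open>g_fun\<close> may have common factors, and where the denominator
  vanishes the HOL quotient has the arbitrary value 0 (even at poles). The value of a rational
  function at a point is therefore taken to be its limit there, so that removable singularities
  are filled in and poles are not roots. The multiplicity of a root is its \<open>zorder\<close>, which also
  only depends on the values in a punctured neighbourhood.
\<close>

definition is_root :: "(complex \<Rightarrow> complex) \<Rightarrow> complex \<Rightarrow> bool" where
  "is_root f z \<longleftrightarrow> (f \<longlongrightarrow> 0) (at z)"

definition has_roots_in :: "(complex \<Rightarrow> complex) \<Rightarrow> nat \<Rightarrow> complex set \<Rightarrow> bool" where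
  "has_roots_in f m A \<longleftrightarrow>
     finite {z \<in> A. is_root f z} \<and> (\<Sum>z | z \<in> A \<and> is_root f z. zorder f z) = int m"

end

theory Submission
  imports Defs
begin

text \<open>
  Near its zero \<open>z0\<close> of order \<open>m\<close>, \<open>g\<close> factors as \<open>h z * (z - z0) ^ m\<close>, where \<open>h\<close> is
  holomorphic and \<open>norm (h z)\<close> is bounded below by some \<open>c > 0\<close>. On the circle of radius
  \<open>\<epsilon> = K * (\<rho> powr (1 / m)) ^ (2 * n)\<close> around \<open>z0\<close> this gives
  \<open>norm (g z) \<ge> c * \<epsilon> ^ m = c * K ^ m * \<rho> ^ (2 * n)\<close>. As \<open>\<epsilon>\<close> tends to 0, for large \<open>n\<close> the whole
  circle lies in the open disc of radius \<open>\<rho>\<close> about the origin, so that there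
  \<open>norm (z ^ (2 * n)) < \<rho> ^ (2 * n)\<close>. Once \<open>c * K ^ m \<ge> 1\<close>, the power is therefore dominated
  by \<open>g\<close> on the circle, and Rouche's theorem gives \<open>z ^ (2 * n) - g z\<close> as many roots inside as
  \<open>g\<close> has, namely \<open>m\<close>.

  The argument applies to any such \<open>g\<close> and to all powers \<open>z ^ n\<close>
  (\<open>has_roots_in_power_minus\<close>, with the Rouche step in \<open>has_roots_in_ball_Rouche\<close>). The particular
  rational function enters only through being meromorphic and not locally zero, which makes the
  factorisation available.
\<close>

text \<open>
  Roots and their multiplicities only depend on punctured neighbourhoods, so an exceptional point
  \<open>z0\<close> is harmless. This is what allows \<open>g\<close>, whose value at a removable singularity is arbitrary,
  to be replaced by its holomorphic extension.
\<close>
lemma has_roots_in_cong: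
  assumes "open A" "\<And>z. z \<in> A \<Longrightarrow> z \<noteq> z0 \<Longrightarrow> f z = F z"
  shows "has_roots_in f m A \<longleftrightarrow> has_roots_in F m A"
proof -
  have ev: "eventually (\<lambda>w. f w = F w) (at z)" if "z \<in> A" for z
  proof -
    have "eventually (\<lambda>w. w \<in> A) (at z)"
      using assms(1) that by (rule eventually_at_in_open')
    moreover have "eventually (\<lambda>w. w \<noteq> z0) (at z)"
      by (rule eventually_neq_at_within)
    ultimately show ?thesis
      by eventually_elim (rule assms(2))
  qed
  have "is_root f z \<longleftrightarrow> is_root F z" if "z \<in> A" for z
    unfolding is_root_def by (rule filterlim_cong[OF refl refl ev[OF that]])
  then have "{z \<in> A. is_root f z} = {z \<in> A. is_root F z}"
    by blast
  moreover have "zorder f z = zorder F z" if "z \<in> A" for z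
    using ev[OF that] by (rule zorder_cong) simp
  then have "(\<Sum>z | z \<in> A \<and> is_root F z. zorder f z) = (\<Sum>z | z \<in> A \<and> is_root F z. zorder F z)"
    by (intro sum.cong) auto
  ultimately show ?thesis
    unfolding has_roots_in_def by simp
qed

lemma is_root_iff_zero:
  assumes "F holomorphic_on A" "open A" "z \<in> A"
  shows "is_root F z \<longleftrightarrow> F z = 0"
proof -
  have "isCont F z"
    using assms by (meson continuous_on_eq_continuous_at holomorphic_on_imp_continuous_on)
  then have "(F \<longlongrightarrow> F z) (at z)"
    by (simp add: isCont_def)
  then show ?thesis
    unfolding is_root_def by (metis LIM_unique)
qed

text \<open>
  Rouche's theorem, applied to the dominant term \<open>- h z * (z - z0) ^ m\<close> and the perturbation \<open>q\<close>:
  the only possible zero of the dominant term is \<open>z0\<close>, of order \<open>m\<close>. The library version counts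
  zeros weighted by winding numbers, so what remains is to pass to the interior of the circle.
\<close>
lemma has_roots_in_ball_Rouche:
  fixes h q :: "complex \<Rightarrow> complex"
  assumes h: "h holomorphic_on ball z0 r" and q: "q holomorphic_on ball z0 r"
    and nz: "\<And>z. z \<in> ball z0 r \<Longrightarrow> h z \<noteq> 0"
    and e: "0 < e" "e < r"
    and less: "\<And>z. z \<in> sphere z0 e \<Longrightarrow> norm (q z) < norm (h z) * e ^ m"
  shows "has_roots_in (\<lambda>z. q z - h z * (z - z0) ^ m) m (ball z0 e)"
proof -
  define G where "G = (\<lambda>z. - (h z * (z - z0) ^ m))"
  define F where "F = (\<lambda>z. G z + q z)"
  \<comment> \<open>Zeros of \<open>F\<close> might accumulate at the boundary of \<open>ball z0 r\<close>, but the domain for Rouche's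
    theorem must contain only finitely many; hence a slightly smaller disc.\<close>
  obtain d where d: "e < d" "d < r"
    using dense[OF e(2)] by blast
  let ?S = "ball z0 d" and ?C = "circlepath z0 e"
  have S: "?S \<subseteq> ball z0 r" "ball z0 e \<subseteq> ?S" "cball z0 d \<subseteq> ball z0 r"
    using d by auto
  have Gh: "G holomorphic_on ball z0 r"
    unfolding G_def by (intro holomorphic_intros h)
  have Fh: "F holomorphic_on ball z0 r"
    unfolding F_def by (intro holomorphic_intros Gh q)
  have dom: "norm (q z) < norm (G z)" if "z \<in> sphere z0 e" for z
    using less[OF that] that by (simp add: G_def norm_mult norm_power dist_norm norm_minus_commute)
  have F_sphere: "F z \<noteq> 0" if "z \<in> sphere z0 e" for z
  proof
    assume "F z = 0"
    then have "q z = - G z"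
      by (simp add: F_def add_eq_0_iff)
    then show False
      using dom[OF that] by simp
  qed
  have "finite {z \<in> cball z0 d. F z = 0}"
  proof (cases "F constant_on ball z0 r")
    case True
    then obtain c where c: "\<And>z. z \<in> ball z0 r \<Longrightarrow> F z = c"
      unfolding constant_on_def by blast
    have "z0 + of_real e \<in> sphere z0 e"
      using e by (simp add: dist_norm)
    then have "c \<noteq> 0"
      using F_sphere c e by fastforce
    then have "{z \<in> cball z0 d. F z = 0} = {}"
      using c S by auto
    then show ?thesis
      by (simp only: finite.emptyI)
  next
    case False
    then show ?thesis
      using S by (intro holomorphic_compact_finite_zeros[OF Fh]) auto
  qed
  then have finF: "finite {z \<in> ?S. F z = 0}"
    by (rule rev_finite_subset) auto
  have ZG: "{z \<in> ?S. G z = 0} = (if m = 0 then {} else {z0})"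
    using nz d e by (auto simp: G_def)
  have zG: "zorder G z0 = int m"
    by (rule zorder_eqI[of "ball z0 r" _ "\<lambda>z. - h z"])
      (use e in \<open>auto intro!: holomorphic_intros h simp: nz G_def\<close>)
  have wn_in: "winding_number ?C z = 1" if "z \<in> ball z0 e" for z
    using that by (intro winding_number_circlepath) (simp add: dist_norm norm_minus_commute)
  have wn_out: "winding_number ?C z = 0" if "z \<notin> cball z0 e" for z
    by (rule winding_number_zero_outside[of _ "cball z0 e"]) (use that e in auto)
  have "(\<Sum>p\<in>{p\<in>?S. F p = 0}. winding_number ?C p * zorder F p)
      = (\<Sum>p\<in>{p\<in>?S. G p = 0}. winding_number ?C p * zorder G p)"
    unfolding F_def
  proof (rule Rouche_theorem)
    show "finite {p \<in> ?S. G p + q p = 0}"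
      using finF by (simp add: F_def)
    show "finite {p \<in> ?S. G p = 0}"
      unfolding ZG by simp
    show "G holomorphic_on ?S" "q holomorphic_on ?S"
      using Gh q S holomorphic_on_subset by blast+
    show "path_image ?C \<subseteq> ?S"
      using d e by (auto simp: path_image_circlepath)
    show "\<forall>z\<in>path_image ?C. norm (q z) < norm (G z)"
      using dom e by simp
    show "\<forall>z. z \<notin> ?S \<longrightarrow> winding_number ?C z = 0"
      using wn_out d by auto
  qed auto
  also have "\<dots> = of_nat m"
    unfolding ZG using wn_in[of z0] e by (simp add: zG)
  also have "(\<Sum>p\<in>{p\<in>?S. F p = 0}. winding_number ?C p * zorder F p)
      = (\<Sum>p | p \<in> ball z0 e \<and> F p = 0. winding_number ?C p * zorder F p)"
  proof (rule sum.mono_neutral_right)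
    show "\<forall>p\<in>{p \<in> ?S. F p = 0} - {p. p \<in> ball z0 e \<and> F p = 0}. winding_number ?C p * zorder F p = 0"
    proof
      fix p assume "p \<in> {p \<in> ?S. F p = 0} - {p. p \<in> ball z0 e \<and> F p = 0}"
      then have "p \<notin> cball z0 e"
        using F_sphere[of p] by auto
      then show "winding_number ?C p * zorder F p = 0"
        by (simp add: wn_out)
    qed
  qed (use finF S in auto)
  also have "\<dots> = of_int (\<Sum>p | p \<in> ball z0 e \<and> F p = 0. zorder F p)"
    by (simp add: wn_in)
  finally have "of_int (\<Sum>p | p \<in> ball z0 e \<and> F p = 0. zorder F p) = (of_int (int m) :: complex)"
    by simp
  then have count: "(\<Sum>p | p \<in> ball z0 e \<and> F p = 0. zorder F p) = int m"
    by (simp only: of_int_eq_iff)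
  have roots: "{z \<in> ball z0 e. is_root F z} = {z \<in> ball z0 e. F z = 0}"
    using is_root_iff_zero[OF Fh] e by auto
  have "finite {z \<in> ball z0 e. F z = 0}"
    using finF by (rule rev_finite_subset) (use S in auto)
  then have "has_roots_in F m (ball z0 e)"
    using count unfolding has_roots_in_def roots by simp
  also have "F = (\<lambda>z. q z - h z * (z - z0) ^ m)"
    by (simp add: F_def G_def fun_eq_iff)
  finally show ?thesis .
qed

text \<open>
  The radius is chosen so that its \<open>m\<close>-th power, the size of \<open>(z - z0) ^ m\<close> on the circle, is a
  constant times \<open>\<rho> ^ n\<close>, whereas \<open>z ^ n\<close> is of size less than \<open>\<rho> ^ n\<close> as soon as the circle has
  shrunk into the disc of radius \<open>\<rho>\<close> about the origin.
\<close>
lemma has_roots_in_power_minus: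
  fixes g h :: "complex \<Rightarrow> complex" and m :: nat
  assumes h: "h holomorphic_on ball z0 r" and r: "0 < r" and m: "0 < m"
    and c: "0 < c" "\<And>z. z \<in> ball z0 r \<Longrightarrow> c \<le> norm (h z)"
    and g: "\<And>z. z \<in> ball z0 r - {z0} \<Longrightarrow> g z = h z * (z - z0) ^ m"
    and \<rho>: "norm z0 < \<rho>" "\<rho> < 1"
  shows "\<exists>K::real. K > 0 \<and>
    (\<forall>\<^sub>F n::nat in sequentially.
       has_roots_in (\<lambda>z. z ^ n - g z) m (ball z0 (K * (\<rho> powr (1 / real m)) ^ n)))"
proof (intro exI conjI)
  \<comment> \<open>The term \<open>1 / c\<close> yields \<open>c * K \<ge> 1\<close>, and \<open>K \<ge> 1\<close> preserves this when \<open>K\<close> becomes \<open>K ^ m\<close>.\<close>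
  let ?K = "max 1 (1 / c)"
  define t where "t = \<rho> powr (1 / real m)"
  have \<rho>0: "0 < \<rho>"
    using \<rho>(1) norm_ge_zero[of z0] by linarith
  have t: "0 < t" "t < 1"
    using \<rho>0 \<rho> m powr_less_mono2[of "1 / real m" \<rho> 1] by (auto simp: t_def)
  have tm: "t ^ m = \<rho>"
    using \<rho>0 m by (simp add: t_def powr_powr flip: powr_realpow')
  show "?K > 0"
    by simp
  have K: "1 \<le> c * ?K ^ m"
  proof -
    have "1 \<le> c * ?K"
      using c(1) by (simp add: max_def field_simps)
    also have "\<dots> \<le> c * ?K ^ m"
      using c(1) m by (intro mult_left_mono self_le_power) auto
    finally show ?thesis .
  qed
  have "(\<lambda>n. ?K * t ^ n) \<longlonglongrightarrow> ?K * 0"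
    using t by (intro tendsto_intros LIMSEQ_realpow_zero) auto
  then have lim: "(\<lambda>n. ?K * t ^ n) \<longlonglongrightarrow> 0"
    by simp
  have "\<forall>\<^sub>F n in sequentially. ?K * t ^ n < min r (\<rho> - norm z0)"
    by (rule order_tendstoD[OF lim]) (use r \<rho> in auto)
  moreover have "\<forall>\<^sub>F n::nat in sequentially. 0 < n"
    by (rule eventually_gt_at_top)
  ultimately show "\<forall>\<^sub>F n in sequentially.
      has_roots_in (\<lambda>z. z ^ n - g z) m (ball z0 (?K * (\<rho> powr (1 / real m)) ^ n))"
    unfolding t_def[symmetric]
  proof eventually_elim
    case (elim n)
    define e where "e = ?K * t ^ n"
    have e: "0 < e" "e < r" "e < \<rho> - norm z0"
      using elim t by (auto simp: e_def)
    have "has_roots_in (\<lambda>z. z ^ n - h z * (z - z0) ^ m) m (ball z0 e)"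
    proof (rule has_roots_in_ball_Rouche[OF h _ _ e(1,2)])
      fix z assume z: "z \<in> sphere z0 e"
      have "norm z \<le> norm z0 + e"
        using z norm_triangle_ineq[of z0 "z - z0"] by (simp add: dist_norm norm_minus_commute)
      then have "norm (z ^ n) < \<rho> ^ n"
        using e elim by (auto simp: norm_power intro!: power_strict_mono)
      also have "\<dots> \<le> c * ?K ^ m * \<rho> ^ n"
        using mult_right_mono[OF K, of "\<rho> ^ n"] \<rho>0 by simp
      also have "\<dots> = c * e ^ m"
        by (simp add: e_def power_mult_distrib tm flip: power_mult)
          (simp add: mult.commute[of n] power_mult tm)
      also have "\<dots> \<le> norm (h z) * e ^ m"
        using z e by (intro mult_right_mono c) auto
      finally show "norm (z ^ n) < norm (h z) * e ^ m" .
    next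
      show "h z \<noteq> 0" if "z \<in> ball z0 r" for z
        using c(1) c(2)[OF that] by auto
    qed (intro holomorphic_intros)
    moreover have "has_roots_in (\<lambda>z. z ^ n - g z) m (ball z0 e) \<longleftrightarrow>
        has_roots_in (\<lambda>z. z ^ n - h z * (z - z0) ^ m) m (ball z0 e)"
      by (rule has_roots_in_cong[of _ z0]) (use e g in auto)
    ultimately show ?case
      by (simp add: e_def)
  qed
qed

lemma g_fun_eq_poly:
  "g_fun b0 b1 cm1 c0 z =
     poly ([:1, b0, b1:] * [:1, c0, cm1:]) z / poly ([:b1, b0, 1:] * [:cm1, c0, 1:]) z"
  by (simp add: g_fun_def power2_eq_square algebra_simps)

text \<open>
  For every choice of the parameters the numerator has constant coefficient 1 and the denominator
  is monic, so both are nonzero polynomials and have only finitely many roots.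
\<close>
lemma eventually_g_fun_nonzero: "\<forall>\<^sub>F z in at w. g_fun b0 b1 cm1 c0 z \<noteq> 0"
proof -
  have ev: "\<forall>\<^sub>F z in at w. poly p z \<noteq> 0" if "p \<noteq> 0" for p :: "complex poly"
    using poly_roots_finite[OF that] islimpt_finite[of "{z. poly p z = 0}" w]
    by (auto simp: islimpt_iff_eventually)
  have "\<forall>\<^sub>F z in at w. poly ([:1, b0, b1:] * [:1, c0, cm1:]) z \<noteq> 0"
    by (rule ev) (simp only: mult_eq_0_iff, simp)
  moreover have "\<forall>\<^sub>F z in at w. poly ([:b1, b0, 1:] * [:cm1, c0, 1:]) z \<noteq> 0"
    by (rule ev) (simp only: mult_eq_0_iff, simp)
  ultimately show ?thesis
    by eventually_elim (simp add: g_fun_eq_poly del: poly_mult mult_pCons_left mult_pCons_right)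
qed

theorem proposition4p1:
  fixes b0 b1 cm1 c0 z0 :: complex and m :: nat and \<rho> :: real
  assumes "is_root (g_fun b0 b1 cm1 c0) z0"
    and "zorder (g_fun b0 b1 cm1 c0) z0 = int m"
    and "norm z0 < 1"
    and "norm z0 < \<rho>" and "\<rho> < 1"
  shows "\<exists>K::real. K > 0 \<and>
    (\<forall>\<^sub>F n::nat in sequentially.
       has_roots_in (\<lambda>z. z ^ (2 * n) - g_fun b0 b1 cm1 c0 z) m
         (ball z0 (K * (\<rho> powr (1 / real m)) ^ (2 * n))))"
proof -
  let ?g = "g_fun b0 b1 cm1 c0"
  define h where "h = zor_poly ?g z0"
  have "?g meromorphic_on {z0}"
    unfolding g_fun_def by (intro meromorphic_intros)
  then have sing: "isolated_singularity_at ?g z0" "not_essential ?g z0"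
    by (simp_all add: meromorphic_at_iff)
  have "\<exists>\<^sub>F z in at z0. ?g z \<noteq> 0"
    using eventually_g_fun_nonzero by (rule eventually_frequently[rotated]) simp
  from zorder_exist[OF sing this] obtain r where h0: "h z0 \<noteq> 0" and r: "r > 0"
    and h: "h holomorphic_on cball z0 r"
    and gh: "\<And>z. z \<in> cball z0 r - {z0} \<Longrightarrow> ?g z = h z * (z - z0) ^ m \<and> h z \<noteq> 0"
    unfolding h_def assms(2) by auto
  have hnz: "h z \<noteq> 0" if "z \<in> cball z0 r" for z
    using gh[of z] h0 that by (cases "z = z0") auto
  have cont: "continuous_on (cball z0 r) h"
    using h by (rule holomorphic_on_imp_continuous_on)
  have "\<exists>w\<in>cball z0 r. \<forall>z\<in>cball z0 r. norm (h w) \<le> norm (h z)"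
    by (rule continuous_attains_inf) (use r cont in \<open>auto intro!: continuous_intros\<close>)
  then obtain w where w: "w \<in> cball z0 r" "\<And>z. z \<in> cball z0 r \<Longrightarrow> norm (h w) \<le> norm (h z)"
    by blast
  \<comment> \<open>For \<open>m = 0\<close>, \<open>g\<close> would tend to \<open>h z0 \<noteq> 0\<close> instead of 0.\<close>
  have "m > 0"
  proof (rule ccontr)
    assume "\<not> m > 0"
    have "\<forall>\<^sub>F z in at z0. z \<in> cball z0 r - {z0}"
      using eventually_at_ball'[OF r, of z0 UNIV] by (rule eventually_mono) auto
    then have "\<forall>\<^sub>F z in at z0. ?g z = h z"
      by (rule eventually_mono) (use gh \<open>\<not> m > 0\<close> in auto)
    then have "(h \<longlongrightarrow> 0) (at z0)"
      using assms(1) unfolding is_root_def by (rule Lim_transform_eventually[rotated])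
    moreover have "(h \<longlongrightarrow> h z0) (at z0)"
      using continuous_on_interior[OF cont, of z0] r by (simp add: isCont_def)
    ultimately show False
      using h0 LIM_unique by blast
  qed
  have "\<exists>K::real. K > 0 \<and> (\<forall>\<^sub>F n::nat in sequentially.
       has_roots_in (\<lambda>z. z ^ n - ?g z) m (ball z0 (K * (\<rho> powr (1 / real m)) ^ n)))"
  proof (rule has_roots_in_power_minus[OF _ r \<open>m > 0\<close> _ _ _ assms(4,5)])
    show "h holomorphic_on ball z0 r"
      using h ball_subset_cball by (rule holomorphic_on_subset)
    show "0 < norm (h w)"
      using hnz w by simp
  qed (use w gh in auto)
  then obtain K :: real where K: "K > 0" "\<forall>\<^sub>F n::nat in sequentially.
       has_roots_in (\<lambda>z. z ^ n - ?g z) m (ball z0 (K * (\<rho> powr (1 / real m)) ^ n))"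
    by blast
  have "filterlim (\<lambda>n::nat. 2 * n) sequentially sequentially"
    by (rule filterlim_subseq) (simp add: strict_mono_def)
  from eventually_compose_filterlim[OF K(2) this] K(1) show ?thesis
    by blast
qed

end
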